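(* Let $(\mathcal{A},\bullet,\omega)$ be a pre-symplectic left-symmetric algebra over $\mathbb{K}$ such that $[\mathcal{A},\mathcal{A}]$ is nondegenerate with respect to $\omega$. Then $(\mathcal{A},\bullet)$ is a Novikov algebra (so $(\mathcal{A},\bullet,\omega)$ is a pre-symplectic Novikov algebra).
   Context: $\mathbb{K}$ is a field of characteristic $0$; all vector spaces are finite-dimensional. For an algebra $(\mathcal{A},\bullet)$: $[u,v]_\bullet=u\bullet v-v\bullet u$ and $[\mathcal{A},\mathcal{A}]=\mathrm{span}\{[u,v]_\bullet\}$. With $(u,v,w)=(u\bullet v)\bullet w-u\bullet(v\bullet w)$, the algebra is left-symmetric if $(u,v,w)=(v,u,w)$ for all $u,v,w$; Novikov if it is left-symmetric and $(u\bullet v)\bullet w=(u\bullet w)\bullet v$ for all $u,v,w$. A pre-symplectic left-symmetric algebra is a triple $(\mathcal{A},\bullet,\omega)$ with $(\mathcal{A},\bullet)$ left-symmetric and $\omega$ a nondegenerate skew-symmetric bilinear form such that $\omega(u\bullet v,w)=\omega(v,u\bullet w)$ for all $u,v,w$; it is a pre-symplectic Novikov algebra if moreover $(\mathcal{A},\bullet)$ is Novikov. A subspace $F$ is nondegenerate if $F\cap F^\perp=\{0\}$, where $F^\perp=\{x:\omega(x,y)=0\ \forall y\in F\}$. *)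

theory Defs
  imports Complex_Main
begin

text \<open>
  Algebras live on a whole type \<open>'v\<close> carrying a finite-dimensional vector space structure
  \<open>scale\<close> over a field of characteristic 0. \<open>Basis\<close> is the arbitrary finite basis by which
  the library locale expresses finite dimension; nothing else refers to it.
\<close>

locale fd_algebra = finite_dimensional_vector_space scale Basis
  for scale :: "'k::field_char_0 \<Rightarrow> 'v::ab_group_add \<Rightarrow> 'v"  (infixr \<open>*s\<close> 75)
  and Basis :: "'v set" +
  fixes mult :: "'v \<Rightarrow> 'v \<Rightarrow> 'v"  (infixl \<open>\<bullet>\<close> 70)
  assumes mult_linear_left: "Vector_Spaces.linear scale scale (\<lambda>u. u \<bullet> v)"
    and mult_linear_right: "Vector_Spaces.linear scale scale (\<lambda>v. u \<bullet> v)"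
begin

definition commutator :: "'v \<Rightarrow> 'v \<Rightarrow> 'v"
  where "commutator u v = u \<bullet> v - v \<bullet> u"

definition associator :: "'v \<Rightarrow> 'v \<Rightarrow> 'v \<Rightarrow> 'v"
  where "associator u v w = (u \<bullet> v) \<bullet> w - u \<bullet> (v \<bullet> w)"

definition commutator_space :: "'v set"
  where "commutator_space = span {commutator u v | u v. True}"

end

locale left_symmetric_algebra = fd_algebra +
  assumes left_symmetric: "associator u v w = associator v u w"

locale novikov_algebra = left_symmetric_algebra +
  assumes right_commute: "(u \<bullet> v) \<bullet> w = (u \<bullet> w) \<bullet> v"

definition orthogonal_space :: "('v \<Rightarrow> 'v \<Rightarrow> 'k::zero) \<Rightarrow> 'v set \<Rightarrow> 'v set"
  where "orthogonal_space \<omega> F = {x. \<forall>y\<in>F. \<omega> x y = 0}"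

definition nondegenerate_subspace ::
    "('v::zero \<Rightarrow> 'v \<Rightarrow> 'k::zero) \<Rightarrow> 'v set \<Rightarrow> bool"
  where "nondegenerate_subspace \<omega> F \<longleftrightarrow> F \<inter> orthogonal_space \<omega> F = {0}"

locale pre_symplectic_left_symmetric_algebra =
  left_symmetric_algebra scale Basis mult
  for scale :: "'k::field_char_0 \<Rightarrow> 'v::ab_group_add \<Rightarrow> 'v"  (infixr \<open>*s\<close> 75)
  and Basis :: "'v set"
  and mult :: "'v \<Rightarrow> 'v \<Rightarrow> 'v"  (infixl \<open>\<bullet>\<close> 70) +
  fixes \<omega> :: "'v \<Rightarrow> 'v \<Rightarrow> 'k"
  assumes form_linear_left: "Vector_Spaces.linear scale (*) (\<lambda>x. \<omega> x y)"
    and form_linear_right: "Vector_Spaces.linear scale (*) (\<lambda>y. \<omega> x y)"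
    and form_skew_symmetric: "\<omega> x y = - \<omega> y x"
    and form_nondegenerate: "(\<And>y. \<omega> x y = 0) \<Longrightarrow> x = 0"
    and form_compatible: "\<omega> (u \<bullet> v) w = \<omega> v (u \<bullet> w)"

locale pre_symplectic_novikov_algebra =
  pre_symplectic_left_symmetric_algebra scale Basis mult \<omega> + novikov_algebra scale Basis mult
  for scale :: "'k::field_char_0 \<Rightarrow> 'v::ab_group_add \<Rightarrow> 'v"  (infixr \<open>*s\<close> 75)
  and Basis :: "'v set"
  and mult :: "'v \<Rightarrow> 'v \<Rightarrow> 'v"  (infixl \<open>\<bullet>\<close> 70)
  and \<omega> :: "'v \<Rightarrow> 'v \<Rightarrow> 'k"

end

theory Submission
  imports Defs
begin

text \<open>
  The proof gives more than the Novikov identity: \<open>(u \<bullet> v) \<bullet> w = 0\<close> for all \<open>u\<close>, \<open>v\<close>, \<open>w\<close>.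

  Write \<open>L\<^sub>u\<close> for left multiplication by \<open>u\<close>. Compatibility says that every \<open>L\<^sub>u\<close> is
  \<open>\<omega>\<close>-selfadjoint, so the commutator \<open>[L\<^sub>u, L\<^sub>v]\<close> is anti-selfadjoint. Left symmetry says
  \<open>[L\<^sub>u, L\<^sub>v] = L\<^bsub>[u,v]\<^esub>\<close>, which is selfadjoint as well, so it vanishes in characteristic 0:
  the commutator space \<open>C\<close> acts by zero from the left.

  Since \<open>C\<close> is nondegenerate and finite-dimensional, the algebra is \<open>C + D\<close> with
  \<open>D = C\<^sup>\<bottom>\<close> (\<open>nondegenerate_subspace_decomposition\<close>). For \<open>d \<in> D\<close> one has \<open>A \<bullet> d \<subseteq> D\<close>,
  because \<open>\<omega> c (x \<bullet> d) = \<omega> (x \<bullet> c) d\<close> and \<open>x \<bullet> c = [x, c] \<in> C\<close>. On \<open>D\<close> the trilinear form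
  \<open>\<omega> (x \<bullet> y) z\<close> is symmetric in \<open>x\<close>, \<open>y\<close>, as \<open>z\<close> is orthogonal to \<open>[x, y]\<close>, and
  antisymmetric in \<open>y\<close>, \<open>z\<close> by selfadjointness; such a form is zero. So \<open>D \<bullet> D\<close> is
  orthogonal to \<open>D\<close>, and to \<open>C\<close> because it lies in \<open>D\<close>; hence \<open>D \<bullet> D = 0\<close>.

  Decompose \<open>u = c + d\<close> and \<open>v = c' + d'\<close> along \<open>C + D\<close>. Only \<open>u \<bullet> v = d \<bullet> c'\<close>
  survives, and it lies in \<open>C\<close>, being the commutator \<open>[d, c']\<close>. So \<open>u \<bullet> v\<close> acts by zero
  from the left.
\<close>

text \<open>
  If \<open>B\<close> is a basis of \<open>C\<close>, the map \<open>T x = (\<Sum>b\<in>B. \<beta> x b *s b)\<close> has kernel \<open>C\<^sup>\<bottom>\<close>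
  and takes values in \<open>C\<close>. Nondegeneracy makes it injective on \<open>C\<close>, hence \<open>T ` C = C\<close>, and
  the component of \<open>x\<close> in \<open>C\<close> is the \<open>c \<in> C\<close> with \<open>T c = T x\<close>. The map \<open>T\<close> replaces
  restriction of functionals to \<open>C\<close> and so avoids the dual space.
\<close>

lemma (in finite_dimensional_vector_space) nondegenerate_subspace_decomposition:
  assumes left: "\<And>y. Vector_Spaces.linear scale (*) (\<lambda>x. \<beta> x y)"
    and right: "\<And>x. Vector_Spaces.linear scale (*) (\<lambda>y. \<beta> x y)"
    and C: "subspace C"
    and nondeg: "nondegenerate_subspace \<beta> C"
  obtains c where "c \<in> C" and "x - c \<in> orthogonal_space \<beta> C"
proof -
  note vs = vector_space_axioms
  interpret pair: finite_dimensional_vector_space_pair_1 scale Basis scale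
    by unfold_locales
  obtain B where B: "B \<subseteq> C" "independent B" "C \<subseteq> span B" "card B = dim C"
    by (rule basis_exists)
  have [simp]: "finite B"
    using B(2) by (rule finiteI_independent)
  define T where "T x = (\<Sum>b\<in>B. scale (\<beta> x b) b)" for x
  have add: "\<beta> (x + y) z = \<beta> x z + \<beta> y z" and scl: "\<beta> (scale a x) z = a * \<beta> x z" for a x y z
    using left[of z] by (auto simp: Vector_Spaces.linear_iff)
  have diff: "\<beta> (x - y) z = \<beta> x z - \<beta> y z" for x y z
    using add[of "x - y" y z] by simp
  have T_linear: "Vector_Spaces.linear scale scale T"
    using vs unfolding Vector_Spaces.linear_iff T_def
    by (simp add: add scl scale_left_distrib sum.distrib scale_sum_right)
  have kernel: "x \<in> orthogonal_space \<beta> C" if "T x = 0" for x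
  proof -
    have "\<beta> x b = 0" if "b \<in> B" for b
      using that \<open>T x = 0\<close> B(2) unfolding T_def independent_explicit by blast
    moreover have "subspace {y. \<beta> x y = 0}"
      using right[of x] unfolding subspace_def Vector_Spaces.linear_iff
      by (metis (mono_tags, lifting) add.right_neutral mem_Collect_eq mult_zero_right mult_zero_left
          scale_zero_left)
    ultimately have "span B \<subseteq> {y. \<beta> x y = 0}"
      by (intro span_minimal) auto
    then show ?thesis
      using B(3) by (auto simp: orthogonal_space_def)
  qed
  have T_diff: "T (x - y) = T x - T y" for x y
    by (simp add: T_def diff scale_left_diff_distrib sum_subtractf)
  have "inj_on T C"
  proof (rule inj_onI)
    fix x y assume "x \<in> C" "y \<in> C" "T x = T y"
    then have "x - y \<in> C \<inter> orthogonal_space \<beta> C"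
      using C kernel by (simp add: subspace_diff T_diff)
    then show "x = y"
      using nondeg unfolding nondegenerate_subspace_def by (metis eq_iff_diff_eq_0 singletonD)
  qed
  moreover have "span C = C"
    using C by simp
  ultimately have dim: "dim (T ` C) = dim C"
    using pair.dim_image_eq[OF T_linear, of C] by metis
  have T_in: "T x \<in> C" for x
    unfolding T_def using B(1) C by (intro subspace_sum subspace_scale) auto
  have "subspace (T ` C)"
    using pair.linear_subspace_image[OF T_linear C] .
  then have "T ` C = C"
    using subspace_dim_equal[of "T ` C" C] C dim T_in by auto
  then obtain c where "c \<in> C" "T c = T x"
    using T_in[of x] by (metis imageE)
  then show thesis
    using that[of c] kernel by (simp add: T_diff)
qed

context fd_algebra
begin

lemma mult_add_left: "mult (u + v) w = mult u w + mult v w"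
  and mult_scale_left: "mult (scale a u) w = scale a (mult u w)"
  using mult_linear_left[of w] by (auto simp: Vector_Spaces.linear_iff)

lemma mult_add_right: "mult w (u + v) = mult w u + mult w v"
  using mult_linear_right[of w] by (auto simp: Vector_Spaces.linear_iff)

lemma mult_zero_left [simp]: "mult 0 w = 0"
  using mult_add_left[of 0 0 w] by simp

lemma mult_diff_left: "mult (u - v) w = mult u w - mult v w"
  using mult_add_left[of "u - v" v w] by simp

lemma subspace_left_annihilator: "subspace {x. \<forall>w. mult x w = 0}"
  by (simp add: subspace_def mult_add_left mult_scale_left)

lemma subspace_commutator_space: "subspace commutator_space"
  by (simp add: commutator_space_def)

lemma commutator_in_commutator_space: "commutator u v \<in> commutator_space"
  unfolding commutator_space_def by (intro span_base) blast

end

lemma (in left_symmetric_algebra) mult_commutator_left: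
  "mult (commutator u v) w = mult u (mult v w) - mult v (mult u w)"
  using left_symmetric[of u v w]
  by (simp add: associator_def commutator_def mult_diff_left algebra_simps)

context pre_symplectic_left_symmetric_algebra
begin

lemma form_add_left: "\<omega> (x + y) z = \<omega> x z + \<omega> y z"
  using form_linear_left[of z] by (auto simp: Vector_Spaces.linear_iff)

lemma form_add_right: "\<omega> z (x + y) = \<omega> z x + \<omega> z y"
  using form_linear_right[of z] by (auto simp: Vector_Spaces.linear_iff)

lemma form_diff_left: "\<omega> (x - y) z = \<omega> x z - \<omega> y z"
  using form_add_left[of "x - y" y z] by simp

lemma form_diff_right: "\<omega> z (x - y) = \<omega> z x - \<omega> z y"
  using form_add_right[of z "x - y" y] by simp

text \<open>
  Left multiplication by \<open>[u, v]\<close> is selfadjoint by compatibility and anti-selfadjoint as the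
  commutator of two selfadjoint operators.
\<close>

lemma mult_commutator_left_eq_0: "mult (commutator u v) w = 0"
proof (rule form_nondegenerate)
  fix z
  have "\<omega> (mult (commutator u v) w) z = \<omega> w (mult v (mult u z)) - \<omega> w (mult u (mult v z))"
    by (simp add: mult_commutator_left form_diff_left form_compatible)
  also have "\<dots> = - \<omega> w (mult (commutator u v) z)"
    by (simp add: mult_commutator_left form_diff_right)
  also have "\<dots> = - \<omega> (mult (commutator u v) w) z"
    by (simp add: form_compatible)
  finally show "\<omega> (mult (commutator u v) w) z = 0"
    by (simp add: eq_neg_iff_add_eq_0 flip: mult_2)
qed

lemma mult_commutator_space_left_eq_0:
  assumes "c \<in> commutator_space"
  shows "mult c w = 0"
proof -
  have "commutator_space \<subseteq> {x. \<forall>w. mult x w = 0}"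
    unfolding commutator_space_def
    by (intro span_minimal subspace_left_annihilator) (auto simp: mult_commutator_left_eq_0)
  then show ?thesis
    using assms by blast
qed

text \<open>Here \<open>x \<bullet> c\<close> is the commutator of \<open>x\<close> and \<open>c\<close>, because \<open>c \<bullet> x = 0\<close>.\<close>

lemma mult_commutator_space_right:
  assumes "c \<in> commutator_space"
  shows "mult x c \<in> commutator_space"
  using commutator_in_commutator_space[of x c] mult_commutator_space_left_eq_0[OF assms]
  by (simp add: commutator_def)

lemma mult_orthogonal_right:
  assumes "d \<in> orthogonal_space \<omega> commutator_space"
  shows "mult x d \<in> orthogonal_space \<omega> commutator_space"
  using assms mult_commutator_space_right
  by (simp add: orthogonal_space_def form_compatible)

text \<open>
  A trilinear form that is symmetric in its first two arguments and antisymmetric in its last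
  two is zero: applying the two transpositions alternately, three times each, restores the
  order of the arguments and collects the sign \<open>(-1)\<^sup>3\<close>.
\<close>

lemma form_mult_orthogonal_eq_0:
  assumes "x \<in> orthogonal_space \<omega> commutator_space" "y \<in> orthogonal_space \<omega> commutator_space"
    and "z \<in> orthogonal_space \<omega> commutator_space"
  shows "\<omega> (mult x y) z = 0"
proof -
  have sym: "\<omega> (mult u v) d = \<omega> (mult v u) d"
    if "d \<in> orthogonal_space \<omega> commutator_space" for u v d
  proof -
    have "\<omega> d (commutator u v) = 0"
      using that commutator_in_commutator_space by (auto simp: orthogonal_space_def)
    then show ?thesis
      by (simp add: commutator_def form_diff_right form_skew_symmetric[of _ d])
  qed
  have anti: "\<omega> (mult u v) w = - \<omega> (mult u w) v" for u v w
    by (metis form_compatible form_skew_symmetric)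
  have "\<omega> (mult x y) z = \<omega> (mult y x) z" by (rule sym[OF assms(3)])
  also have "\<dots> = - \<omega> (mult y z) x" by (rule anti)
  also have "\<dots> = - \<omega> (mult z y) x" by (simp add: sym[OF assms(1), of y z])
  also have "\<dots> = \<omega> (mult z x) y" by (simp add: anti[of z y x])
  also have "\<dots> = \<omega> (mult x z) y" by (rule sym[OF assms(2)])
  also have "\<dots> = - \<omega> (mult x y) z" by (rule anti)
  finally show ?thesis
    by (simp add: eq_neg_iff_add_eq_0 flip: mult_2)
qed

context
  assumes nondeg: "nondegenerate_subspace \<omega> commutator_space"
begin

lemma commutator_space_decomposition:
  obtains c d where "x = c + d" "c \<in> commutator_space" "d \<in> orthogonal_space \<omega> commutator_space"
proof -
  obtain c where "c \<in> commutator_space" "x - c \<in> orthogonal_space \<omega> commutator_space"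
    using nondegenerate_subspace_decomposition[OF form_linear_left form_linear_right
        subspace_commutator_space nondeg] .
  then show thesis
    using that[of c "x - c"] by simp
qed

lemma mult_orthogonal_eq_0:
  assumes "x \<in> orthogonal_space \<omega> commutator_space" "y \<in> orthogonal_space \<omega> commutator_space"
  shows "mult x y = 0"
proof (rule form_nondegenerate)
  fix z
  obtain c d where z: "z = c + d" "c \<in> commutator_space" "d \<in> orthogonal_space \<omega> commutator_space"
    by (rule commutator_space_decomposition)
  have "\<omega> (mult x y) c = 0"
    using mult_orthogonal_right[OF assms(2)] z(2) by (auto simp: orthogonal_space_def)
  then show "\<omega> (mult x y) z = 0"
    using form_mult_orthogonal_eq_0[OF assms z(3)] by (simp add: z(1) form_add_right)
qed

lemma mult_in_commutator_space: "mult u v \<in> commutator_space"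
proof -
  obtain c d where u: "u = c + d" "c \<in> commutator_space" "d \<in> orthogonal_space \<omega> commutator_space"
    by (rule commutator_space_decomposition)
  obtain c' d' where v: "v = c' + d'" "c' \<in> commutator_space"
      "d' \<in> orthogonal_space \<omega> commutator_space"
    by (rule commutator_space_decomposition)
  have "mult u v = mult d c'"
    using mult_commutator_space_left_eq_0[OF u(2)] mult_orthogonal_eq_0[OF u(3) v(3)]
    by (simp add: u(1) v(1) mult_add_left mult_add_right)
  then show ?thesis
    using mult_commutator_space_right[OF v(2)] by simp
qed

lemma mult_mult_left_eq_0: "mult (mult u v) w = 0"
  by (intro mult_commutator_space_left_eq_0 mult_in_commutator_space)

end

end

theorem corollary2p12:
  fixes scale :: "'k::field_char_0 \<Rightarrow> 'v::ab_group_add \<Rightarrow> 'v"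
    and Basis :: "'v set"
    and mult :: "'v \<Rightarrow> 'v \<Rightarrow> 'v"
    and \<omega> :: "'v \<Rightarrow> 'v \<Rightarrow> 'k"
  assumes "pre_symplectic_left_symmetric_algebra scale Basis mult \<omega>"
    and "nondegenerate_subspace \<omega> (fd_algebra.commutator_space scale mult)"
  shows "novikov_algebra scale Basis mult \<and> pre_symplectic_novikov_algebra scale Basis mult \<omega>"
proof -
  interpret pre_symplectic_left_symmetric_algebra scale Basis mult \<omega>
    by (rule assms(1))
  have novikov: "novikov_algebra scale Basis mult"
    by unfold_locales (simp add: mult_mult_left_eq_0[OF assms(2)])
  then interpret novikov_algebra scale Basis mult .
  have "pre_symplectic_novikov_algebra scale Basis mult \<omega>"
    by unfold_locales
  with novikov show ?thesis ..
qed

end
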